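(* Consider the general linear $D_2Q_{13}$ lattice Boltzmann scheme described in the context, with full equilibrium matrix $E$ and diagonal relaxation matrix $S$ (entries in $(0,2)$). The scheme is isotropic at first order if and only if the following two properties hold: (1) at equilibrium the energy is proportional to the density, i.e. $E_\varepsilon^{q_x}=E_\varepsilon^{q_y}=0$; (2) at equilibrium both moments $m_{\varphi_{xx}}$ and $m_{\varphi_{xy}}$ are zero, i.e. $E_{\varphi_{xx}}^{\rho}=E_{\varphi_{xx}}^{q_x}=E_{\varphi_{xx}}^{q_y}=0$ and $E_{\varphi_{xy}}^{\rho}=E_{\varphi_{xy}}^{q_x}=E_{\varphi_{xy}}^{q_y}=0$. (All other coefficients of $E$ are arbitrary and there is no constraint on $S$.)
   Context: **Lattice and velocities.** Space dimension $d=2$; the velocity scale $\lambda>0$ is fixed, and $\Delta t=\Delta x/\lambda$. The $D_2Q_{13}$ scheme has $q=13$ velocities $v_j=(v_j^x,v_j^y)$: $(0,0)$, $(\pm\lambda,0)$, $(0,\pm\lambda)$, $(\pm\lambda,\pm\lambda)$, $(\pm2\lambda,0)$, $(0,\pm2\lambda)$. The distribution is $f=(f_j)_{0\le j\le 12}$. **Moments.** The moment vector is $(W,Y)=Mf$, where each moment is $\sum_j p(v_j)f_j$ for the polynomial $p(v)$ below, with $v=(v^x,v^y)$ and $|v|^2=(v^x)^2+(v^y)^2$. Conserved moments $W=(\rho,q_x,q_y)$ ($N=3$): $1,\ v^x,\ v^y$. Non-conserved moments $Y=(m_\varepsilon,m_{\varphi_{xx}},m_{\varphi_{xy}},m_{\varphi_x},m_{\varphi_y},m_{x\varepsilon_2},m_{y\varepsilon_2},m_{\varepsilon_2},m_{\varepsilon_3},m_{xx\varepsilon})$,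 orthogonalized (the rows of $M$ are pairwise orthogonal): - $m_\varepsilon$: $13|v|^2-28\lambda^2$; - $m_{\varphi_{xx}}$: $(v^x)^2-(v^y)^2$; $m_{\varphi_{xy}}$: $v^xv^y$; - $m_{\varphi_x}$: $(|v|^2-3\lambda^2)v^x$; $m_{\varphi_y}$: $(|v|^2-3\lambda^2)v^y$; - $m_{x\varepsilon_2}$: $(\tfrac{35}{12}|v|^4-\tfrac{63}{4}\lambda^2|v|^2+\tfrac{101}{6}\lambda^4)v^x$; $m_{y\varepsilon_2}$: the same with $v^y$ in place of the last factor $v^x$; - $m_{\varepsilon_2}$: $\tfrac{77}{2}|v|^4-\tfrac{361}{2}\lambda^2|v|^2+140\lambda^4$; - $m_{\varepsilon_3}$: $\tfrac{137}{24}|v|^6-\tfrac{273}{8}\lambda^2|v|^4+\tfrac{581}{12}\lambda^4|v|^2-12\lambda^6$; - $m_{xx\varepsilon}$: $(\tfrac{17}{12}|v|^2-\tfrac{65}{12}\lambda^2)\bigl((v^x)^2-(v^y)^2\bigr)$. **Equilibrium and relaxation.** $Y^{eq}=EW$ with a full real $10\times3$ matrix $E$. Its row associated with the non-conserved moment $m_k$, $k\in\{\varepsilon,\varphi_{xx},\varphi_{xy},\varphi_x,\varphi_y,x\varepsilon_2,y\varepsilon_2,\varepsilon_2,\varepsilon_3,xx\varepsilon\}$, is $(E_k^{\rho}\lambda^{p_k},\,E_k^{q_x}\lambda^{p_k-1},\,E_k^{q_y}\lambda^{p_k-1})$, where $p_k$ is the total degree in velocities of the moment ($p_k=2,2,2,3,3,5,5,4,6,4$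 respectively). $S=\mathrm{Diag}(s_k)$ (same ordering), $0<s_k<2$. The relaxation step is $W^*=W$, $Y^*=Y+S(EW-Y)$, i.e. multiplication of the moment vector by $J=\begin{pmatrix} \mathrm{Id}_3 & 0 \\ S\,E & \mathrm{Id}_{10}-S \end{pmatrix}$. With $f^*=M^{-1}JMf$, one time step is $f_j(x+v_j\Delta t,t+\Delta t)=f_j^*(x,t)$. **Equivalent equations.** Formally, in terms of constant-coefficient differential operators, one time step is $f(t+\Delta t)=e^{-\Delta t\,\Lambda}M^{-1}JM f(t)$ with $\Lambda=\mathrm{diag}(v_j\cdot\nabla)$. There is a unique pair of formal power series in $\Delta t$, with coefficients matrices of constant-coefficient differential operators in $(x,y)$, consisting of a $13\times3$ matrix $\Psi$ whose first three rows form $\mathrm{Id}_3$ and a $3\times3$ matrix $\mathcal A$, such that $Me^{-\Delta t\Lambda}M^{-1}J\,\Psi=\Psi\,e^{-\Delta t\mathcal A}$. It has the form $\mathcal A=\sum_{n\ge1}\Delta t^{\,n-1}A_n\odot\nabla^n$, where $(A_n\odot\nabla^nW)^i=\sum_{j=1}^{3}\sum_{\alpha_1,\dots,\alpha_n\in\{1,2\}}A_{n,j}^{i,\alpha_1\cdots\alpha_n}\partial_{\alpha_1}\cdots\partial_{\alpha_n}W^j$ and $A_n$ does not depend on $\Delta t$. The equivalent equations of order $m$ are $\partial_tW+\sum_{n=1}^m\Delta t^{\,n-1}A_n\odot\nabla^nW=0$. Tensors $A_n$ are identified when they define the same differential operator (equivalently, they are taken symmetric in $\alpha_1,\dots,\alpha_n$).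 **Isotropy.** For $r\in SO_2(\mathbb R)$ let $R(r)=\begin{pmatrix}1&0\\0&r\end{pmatrix}$ and $$\bigl(\Phi_n(r)(A)\bigr)^{i,\alpha_1\cdots\alpha_n}_j=\sum_{\beta_1,\dots,\beta_n=1}^{2}\ \sum_{k,l=1}^{3}R(r)^i_l\,A^{l,\beta_1\cdots\beta_n}_k\,r^{\alpha_1}_{\beta_1}\cdots r^{\alpha_n}_{\beta_n}\,(R(r)^{-1})^k_j .$$ The scheme is isotropic at order $m$ if $\Phi_n(r)(A_n)=A_n$ for all $r\in SO_2(\mathbb R)$ and all $1\le n\le m$. *)

theory Defs
  imports "HOL-Analysis.Analysis"
begin

datatype vel =
    V0 | E1 | W1 | N1 | S1 | NE1 | NW1 | SW1 | SE1 | E2 | W2 | N2 | S2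

datatype ymom =
    MEps | MPhiXX | MPhiXY | MPhiX | MPhiY | MXEps2 | MYEps2 | MEps2 | MEps3 | MXXEps

lemma UNIV_vel: "(UNIV :: vel set) = {V0, E1, W1, N1, S1, NE1, NW1, SW1, SE1, E2, W2, N2, S2}"
proof -
  have "x \<in> {V0, E1, W1, N1, S1, NE1, NW1, SW1, SE1, E2, W2, N2, S2}" for x
    by (cases x) auto
  then show ?thesis by auto
qed

lemma UNIV_ymom: "(UNIV :: ymom set) =
  {MEps, MPhiXX, MPhiXY, MPhiX, MPhiY, MXEps2, MYEps2, MEps2, MEps3, MXXEps}"
proof -
  have "x \<in> {MEps, MPhiXX, MPhiXY, MPhiX, MPhiY, MXEps2, MYEps2, MEps2, MEps3, MXXEps}" for x
    by (cases x) auto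
  then show ?thesis by auto
qed

instance vel :: finite
  by standard (simp add: UNIV_vel)

instance ymom :: finite
  by standard (simp add: UNIV_ymom)

primrec vel_dir :: "vel \<Rightarrow> real^2" where
  "vel_dir V0 = vector [0, 0]"
| "vel_dir E1 = vector [1, 0]"
| "vel_dir W1 = vector [-1, 0]"
| "vel_dir N1 = vector [0, 1]"
| "vel_dir S1 = vector [0, -1]"
| "vel_dir NE1 = vector [1, 1]"
| "vel_dir NW1 = vector [-1, 1]"
| "vel_dir SW1 = vector [-1, -1]"
| "vel_dir SE1 = vector [1, -1]"
| "vel_dir E2 = vector [2, 0]"
| "vel_dir W2 = vector [-2, 0]"
| "vel_dir N2 = vector [0, 2]"
| "vel_dir S2 = vector [0, -2]"

definition velocity :: "real \<Rightarrow> vel \<Rightarrow> real^2" where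
  "velocity lam j = lam *\<^sub>R vel_dir j"

definition cons_poly :: "3 \<Rightarrow> real^2 \<Rightarrow> real" where
  "cons_poly i v = vector [1, v $ 1, v $ 2] $ i"

abbreviation sqn :: "real^2 \<Rightarrow> real" where
  "sqn v \<equiv> (v $ 1)^2 + (v $ 2)^2"

primrec ymom_poly :: "ymom \<Rightarrow> real \<Rightarrow> real^2 \<Rightarrow> real" where
  "ymom_poly MEps lam v = 13 * sqn v - 28 * lam^2"
| "ymom_poly MPhiXX lam v = (v $ 1)^2 - (v $ 2)^2"
| "ymom_poly MPhiXY lam v = v $ 1 * v $ 2"
| "ymom_poly MPhiX lam v = (sqn v - 3 * lam^2) * v $ 1"
| "ymom_poly MPhiY lam v = (sqn v - 3 * lam^2) * v $ 2"
| "ymom_poly MXEps2 lam v =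
     (35/12 * (sqn v)^2 - 63/4 * lam^2 * sqn v + 101/6 * lam^4) * v $ 1"
| "ymom_poly MYEps2 lam v =
     (35/12 * (sqn v)^2 - 63/4 * lam^2 * sqn v + 101/6 * lam^4) * v $ 2"
| "ymom_poly MEps2 lam v = 77/2 * (sqn v)^2 - 361/2 * lam^2 * sqn v + 140 * lam^4"
| "ymom_poly MEps3 lam v =
     137/24 * (sqn v)^3 - 273/8 * lam^2 * (sqn v)^2 + 581/12 * lam^4 * sqn v - 12 * lam^6"
| "ymom_poly MXXEps lam v = (17/12 * sqn v - 65/12 * lam^2) * ((v $ 1)^2 - (v $ 2)^2)"

primrec ymom_degree :: "ymom \<Rightarrow> nat" where
  "ymom_degree MEps = 2"
| "ymom_degree MPhiXX = 2"
| "ymom_degree MPhiXY = 2"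
| "ymom_degree MPhiX = 3"
| "ymom_degree MPhiY = 3"
| "ymom_degree MXEps2 = 5"
| "ymom_degree MYEps2 = 5"
| "ymom_degree MEps2 = 4"
| "ymom_degree MEps3 = 6"
| "ymom_degree MXXEps = 4"

text \<open>The index type \<^typ>\<open>3 + ymom\<close> splits moment vectors into blocks: \<^term>\<open>Inl\<close> for the
  conserved moments \<open>W = (\<rho>, q\<^sub>x, q\<^sub>y)\<close>, \<^term>\<open>Inr\<close> for the non-conserved moments \<open>Y\<close>.\<close>

definition moment_matrix :: "real \<Rightarrow> real^vel^(3 + ymom)" where
  "moment_matrix lam = (\<chi> k j.
     (case k of Inl i \<Rightarrow> cons_poly i (velocity lam j)
              | Inr y \<Rightarrow> ymom_poly y lam (velocity lam j)))"

text \<open>The parameter \<open>e\<close> holds the dimensionless coefficients: \<open>e $ k $ 1\<close>, \<open>e $ k $ 2\<close>,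
  \<open>e $ k $ 3\<close> are \<open>E\<^sub>k\<close> with superscript \<open>\<rho>\<close>, \<open>q\<^sub>x\<close>, \<open>q\<^sub>y\<close>.\<close>

definition equilibrium_matrix :: "real \<Rightarrow> real^3^ymom \<Rightarrow> real^3^ymom" where
  "equilibrium_matrix lam e = (\<chi> k.
     vector [e $ k $ 1 * lam ^ ymom_degree k,
             e $ k $ 2 * lam ^ (ymom_degree k - 1),
             e $ k $ 3 * lam ^ (ymom_degree k - 1)])"

definition diag :: "'a::zero^'n \<Rightarrow> 'a^'n^'n" where
  "diag d = (\<chi> i j. if i = j then d $ i else 0)"

definition relaxation_matrix ::
    "real \<Rightarrow> real^3^ymom \<Rightarrow> real^ymom \<Rightarrow> real^(3 + ymom)^(3 + ymom)" where
  "relaxation_matrix lam e s = (\<chi> k l.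
     (case k of
        Inl i \<Rightarrow> (case l of Inl j \<Rightarrow> (mat 1 :: real^3^3) $ i $ j | Inr y \<Rightarrow> 0)
      | Inr z \<Rightarrow> (case l of Inl j \<Rightarrow> (diag s ** equilibrium_matrix lam e) $ z $ j
                          | Inr y \<Rightarrow> (mat 1 - diag s) $ z $ y)))"

text \<open>Constant-coefficient differential operators in \<open>(x, y)\<close> are polynomials in the commuting
  symbols \<open>\<partial>\<^sub>x\<close> (outer variable) and \<open>\<partial>\<^sub>y\<close> (inner variable); composition is multiplication.\<close>

type_synonym dop = "real poly poly"

definition dconst :: "real \<Rightarrow> dop" where
  "dconst c = [:[:c:]:]"

definition partial :: "2 \<Rightarrow> dop" where
  "partial a = vector [[:0, 1:], [:[:0, 1:]:]] $ a"

text \<open>The variable \<^term>\<open>fps_X\<close> of the formal power series is the time step \<open>\<Delta>t\<close>.\<close>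

type_synonym dseries = "dop fps"

definition lift_matrix :: "real^'m^'n \<Rightarrow> dseries^'m^'n" where
  "lift_matrix A = (\<chi> i j. fps_const (dconst (A $ i $ j)))"

definition matrix_pow :: "'a::semiring_1^'n^'n \<Rightarrow> nat \<Rightarrow> 'a^'n^'n" where
  "matrix_pow A k = (((**) A) ^^ k) (mat 1)"

text \<open>\<open>exp_dt B\<close> is \<open>e\<close> to the power \<open>\<Delta>t B\<close>. The entries of \<open>(\<Delta>t B)\<^sup>k\<close> are divisible by \<open>\<Delta>t\<^sup>k\<close>, so
  the terms \<open>k > n\<close> of the exponential series do not contribute to the coefficient of \<open>\<Delta>t\<^sup>n\<close>.\<close>

definition exp_dt :: "dseries^'n^'n \<Rightarrow> dseries^'n^'n" where
  "exp_dt B = (\<chi> i j. Abs_fps (\<lambda>n. \<Sum>k\<le>n.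
     dconst (1 / fact k) * fps_nth (matrix_pow (\<chi> a b. fps_X * B $ a $ b) k $ i $ j) n))"

definition advection :: "real \<Rightarrow> dseries^vel^vel" where
  "advection lam = diag (\<chi> j. fps_const (\<Sum>a\<in>UNIV. dconst (velocity lam j $ a) * partial a))"

definition equivalent_pair ::
    "real \<Rightarrow> real^3^ymom \<Rightarrow> real^ymom \<Rightarrow> dseries^3^(3 + ymom) \<Rightarrow> dseries^3^3 \<Rightarrow> bool" where
  "equivalent_pair lam e s \<Psi> \<A> \<longleftrightarrow>
     (\<forall>i. \<Psi> $ Inl i = mat 1 $ i) \<and>
     lift_matrix (moment_matrix lam) ** exp_dt (- advection lam)
       ** lift_matrix (matrix_inv (moment_matrix lam))
       ** lift_matrix (relaxation_matrix lam e s) ** \<Psi>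
     = \<Psi> ** exp_dt (- \<A>)"

definition equivalent_operator ::
    "real \<Rightarrow> real^3^ymom \<Rightarrow> real^ymom \<Rightarrow> dseries^3^3" where
  "equivalent_operator lam e s = (THE \<A>. \<exists>\<Psi>. equivalent_pair lam e s \<Psi> \<A>)"

text \<open>A family of tensors of order \<open>n\<close> maps the list \<open>[\<alpha>\<^sub>1, \<dots>, \<alpha>\<^sub>n]\<close> of upper indices to the matrix
  with row index \<open>i\<close> and column index \<open>j\<close>. Lists of length other than \<open>n\<close> are mapped to \<open>0\<close>.\<close>

type_synonym tensor = "2 list \<Rightarrow> real^3^3"

definition symmetric_tensor :: "nat \<Rightarrow> tensor \<Rightarrow> bool" where
  "symmetric_tensor n T \<longleftrightarrow>
     (\<forall>\<alpha>. length \<alpha> \<noteq> n \<longrightarrow> T \<alpha> = 0) \<and>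
     (\<forall>\<alpha> \<beta>. mset \<alpha> = mset \<beta> \<longrightarrow> T \<alpha> = T \<beta>)"

definition nabla_contract :: "nat \<Rightarrow> tensor \<Rightarrow> dop^3^3" where
  "nabla_contract n T = (\<chi> i j. \<Sum>\<alpha> | length \<alpha> = n.
     dconst (T \<alpha> $ i $ j) * prod_list (map partial \<alpha>))"

text \<open>Only used for \<open>n \<ge> 1\<close>: the tensor of the coefficient of \<open>\<Delta>t\<close> to the power \<open>n - 1\<close>.\<close>

definition equivalent_tensor ::
    "real \<Rightarrow> real^3^ymom \<Rightarrow> real^ymom \<Rightarrow> nat \<Rightarrow> tensor" where
  "equivalent_tensor lam e s n = (THE T. symmetric_tensor n T \<and>
     nabla_contract n T = (\<chi> i j. fps_nth (equivalent_operator lam e s $ i $ j) (n - 1)))"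

definition rot3 :: "real^2^2 \<Rightarrow> real^3^3" where
  "rot3 r = vector [vector [1, 0, 0],
                    vector [0, r $ 1 $ 1, r $ 1 $ 2],
                    vector [0, r $ 2 $ 1, r $ 2 $ 2]]"

definition tensor_action :: "nat \<Rightarrow> real^2^2 \<Rightarrow> tensor \<Rightarrow> tensor" where
  "tensor_action n r T = (\<lambda>\<alpha>. if length \<alpha> = n then
     (\<chi> i j. \<Sum>\<beta> | length \<beta> = n. \<Sum>k\<in>UNIV. \<Sum>l\<in>UNIV.
        rot3 r $ i $ l * T \<beta> $ l $ k * (\<Prod>t<n. r $ (\<alpha> ! t) $ (\<beta> ! t))
        * matrix_inv (rot3 r) $ k $ j)
     else 0)"

definition SO2 :: "(real^2^2) set" where
  "SO2 = {r. orthogonal_matrix r \<and> det r = 1}"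

definition isotropic_at_order ::
    "real \<Rightarrow> real^3^ymom \<Rightarrow> real^ymom \<Rightarrow> nat \<Rightarrow> bool" where
  "isotropic_at_order lam e s m \<longleftrightarrow>
     (\<forall>r\<in>SO2. \<forall>n\<in>{1..m}.
        tensor_action n r (equivalent_tensor lam e s n) = equivalent_tensor lam e s n)"

end

theory Submission
  imports Defs
begin

text \<open>Write the one-step operator in moment space as \<open>J + \<Delta>t H\<close>. As \<open>S\<close> is invertible, the
  defining equation of \<open>(\<Psi>, \<A>)\<close> amounts to a fixed point equation \<open>\<Psi> = (Id; E) + \<Delta>t (\<dots>)\<close> together
  with \<open>exp (- \<Delta>t \<A>) = Id + \<Delta>t Q\<close>, where \<open>Q\<close> is the conserved block of \<open>H \<Psi>\<close>. Both are fixed point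
  equations of contractions for the \<open>\<Delta>t\<close>-adic distance, so the pair exists and is unique, and \<open>A\<^sub>1\<close> is
  given by the moments of \<open>\<Lambda> f\<close> with \<open>f\<close> the equilibrium of moments \<open>(Id; E)\<close>. These are second-order
  velocity moments of \<open>f\<close>, hence combinations of \<open>\<rho>\<close> and the equilibria of \<open>m\<close> for \<open>\<epsilon>\<close>, \<open>xx\<close> and \<open>xy\<close>.
  Invariance under the quarter turn alone forces the stated conditions; conversely, they reduce the
  pressure tensor to a multiple of \<open>\<rho> Id\<close>, which is invariant under all rotations.\<close>

section \<open>The \<Delta>t-adic distance and its contractions\<close>

text \<open>Congruence modulo \<open>fps_X ^ n\<close>, that is, closeness for the \<Delta>t-adic
  distance.\<close>

definition agree :: "nat \<Rightarrow> 'a::comm_ring_1 fps^'m^'n \<Rightarrow> 'a fps^'m^'n \<Rightarrow> bool" where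
  "agree n A B \<longleftrightarrow> (\<forall>k<n. \<forall>i j. fps_nth (A $ i $ j) k = fps_nth (B $ i $ j) k)"

text \<open>Entrywise, in the form in which \<open>exp_dt\<close> multiplies its argument by
  \<Delta>t.\<close>

definition scale_dt :: "'a::comm_ring_1 fps^'m^'n \<Rightarrow> 'a fps^'m^'n" where
  "scale_dt A = (\<chi> i j. fps_X * A $ i $ j)"

lemma agree_refl: "agree n A A"
  by (simp add: agree_def)

lemma agree_0: "agree 0 A B"
  by (simp add: agree_def)

lemma agree_add: "agree n A A' \<Longrightarrow> agree n B B' \<Longrightarrow> agree n (A + B) (A' + B')"
  by (simp add: agree_def)

lemma agree_diff: "agree n A A' \<Longrightarrow> agree n B B' \<Longrightarrow> agree n (A - B) (A' - B')"
  by (simp add: agree_def)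

lemma agree_uminus: "agree n A A' \<Longrightarrow> agree n (- A) (- A')"
  by (simp add: agree_def)

lemma agree_mult: "agree n A A' \<Longrightarrow> agree n B B' \<Longrightarrow> agree n (A ** B) (A' ** B')"
  by (simp add: agree_def matrix_matrix_mult_def fps_sum_nth fps_mult_nth)

text \<open>Multiplication by \<Delta>t shifts all coefficients up by one and makes the constant
  term 0. This gain of one order is what makes the maps below contractions.\<close>

lemma agree_scale_dt: "agree n A B \<Longrightarrow> agree (Suc n) (scale_dt A) (scale_dt B)"
  by (auto simp: agree_def scale_dt_def less_Suc_eq_0_disj)

lemma agree_all_imp_eq: "(\<And>n. agree n A B) \<Longrightarrow> A = B"
  unfolding agree_def vec_eq_iff fps_eq_iff by blast

lemma agree_mono: "agree n A B \<Longrightarrow> m \<le> n \<Longrightarrow> agree m A B"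
  by (simp add: agree_def)

lemma agree_trans: "agree n A B \<Longrightarrow> agree n B C \<Longrightarrow> agree n A C"
  by (simp add: agree_def)

text \<open>Banach's argument: the iterates from 0 stabilize coefficient by coefficient, and two
  fixed points agree to every order by induction.\<close>

lemma contraction_fixpoint:
  fixes F :: "'a::comm_ring_1 fps^'m^'n \<Rightarrow> 'a fps^'m^'n"
  assumes contr: "\<And>n A B. agree n A B \<Longrightarrow> agree (Suc n) (F A) (F B)"
  shows "\<exists>!A. A = F A"
proof (rule ex_ex1I)
  define I where "I n = (F ^^ n) 0" for n
  have I_Suc: "I (Suc n) = F (I n)" for n
    by (simp add: I_def)
  have step: "agree n (I n) (I (Suc n))" for n
    by (induction n) (simp_all add: agree_0 I_Suc contr)
  have ge: "agree n (I n) (I (n + d))" for n d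
  proof (induction d)
    case (Suc d)
    have "agree n (I (n + d)) (I (Suc (n + d)))"
      using step agree_mono le_add1 by blast
    with Suc show ?case
      using agree_trans by fastforce
  qed (simp add: agree_refl)
  \<comment> \<open>By \<open>ge\<close>, the coefficients below \<open>n\<close> no longer change
    from iterate \<open>n\<close> on, so coefficient \<open>k\<close> has its final value in iterate
    \<open>k + 1\<close>.\<close>
  define L where "L = (\<chi> i j. Abs_fps (\<lambda>k. fps_nth (I (Suc k) $ i $ j) k))"
  have lim: "agree n L (I n)" for n
    unfolding agree_def
  proof (intro allI impI)
    fix k i j
    assume "k < n"
    then obtain d where "n = Suc k + d"
      using less_iff_Suc_add by auto
    with ge[of "Suc k" d] show "fps_nth (L $ i $ j) k = fps_nth (I n $ i $ j) k"
      by (simp add: agree_def L_def)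
  qed
  have "agree n L (F L)" for n
  proof -
    have "agree (Suc n) (F L) (I (Suc n))"
      using contr[OF lim] by (simp add: I_Suc)
    then show ?thesis
      using lim[of "Suc n"] by (simp add: agree_def)
  qed
  then show "\<exists>A. A = F A"
    using agree_all_imp_eq by blast
next
  fix A B
  assume "A = F A" "B = F B"
  then have "agree n A B" for n
    by (induction n) (metis agree_0, metis contr)
  then show "A = B"
    by (rule agree_all_imp_eq)
qed

section \<open>Factors of \<Delta>t, matrix powers, exponential and logarithm\<close>

lemma matrix_add_rdistrib: "(A + B) ** C = A ** C + B ** C"
  by (vector matrix_matrix_mult_def sum.distrib[symmetric] field_simps)

lemma scale_dt_mult_left: "scale_dt A ** B = scale_dt (A ** B)"
  by (vector scale_dt_def matrix_matrix_mult_def) (simp add: sum_distrib_left mult.assoc)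

lemma scale_dt_mult_right: "A ** scale_dt B = scale_dt (A ** B)"
  by (vector scale_dt_def matrix_matrix_mult_def) (simp add: sum_distrib_left mult_ac)

lemma scale_dt_add: "scale_dt (A + B) = scale_dt A + scale_dt B"
  by (vector scale_dt_def) (simp add: algebra_simps)

lemma scale_dt_inject: "scale_dt A = scale_dt B \<longleftrightarrow> A = B"
proof
  assume "scale_dt A = scale_dt B"
  then have "fps_nth (scale_dt A $ i $ j) (Suc n) = fps_nth (scale_dt B $ i $ j) (Suc n)" for i j n
    by simp
  then show "A = B"
    by (simp add: scale_dt_def vec_eq_iff fps_eq_iff)
qed simp

lemma matrix_pow_Suc: "matrix_pow A (Suc k) = A ** matrix_pow A k"
  by (simp add: matrix_pow_def)

lemma matrix_pow_scale_dt: "matrix_pow (scale_dt A) k $ i $ j = fps_X ^ k * matrix_pow A k $ i $ j"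
proof (induction k arbitrary: i j)
  case (Suc k)
  then show ?case
    by (simp add: matrix_pow_Suc scale_dt_def matrix_matrix_mult_def sum_distrib_left mult_ac)
qed (simp add: matrix_pow_def)

lemma agree_matrix_pow: "agree n A B \<Longrightarrow> agree n (matrix_pow A k) (matrix_pow B k)"
proof (induction k)
  case 0
  then show ?case
    by (simp add: matrix_pow_def agree_refl)
qed (simp add: matrix_pow_Suc agree_mult)

text \<open>\<open>exp_tail B\<close> stands for the exponential series of \<open>\<Delta>t B\<close> without its first two terms, divided by
  the square of \<open>\<Delta>t\<close>.\<close>

definition exp_tail :: "dseries^'n^'n \<Rightarrow> dseries^'n^'n" where
  "exp_tail B = (\<chi> i j. Abs_fps (\<lambda>n. \<Sum>k\<le>n.
     dconst (1 / fact (Suc (Suc k))) * fps_nth (matrix_pow B (Suc (Suc k)) $ i $ j) (n - k)))"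

lemma dconst_0 [simp]: "dconst 0 = 0"
  and dconst_1 [simp]: "dconst 1 = 1"
  by (simp_all add: dconst_def one_pCons)

lemma dconst_add: "dconst (a + b) = dconst a + dconst b"
  and dconst_diff: "dconst (a - b) = dconst a - dconst b"
  and dconst_mult: "dconst (a * b) = dconst a * dconst b"
  by (simp_all add: dconst_def)

lemma dconst_sum: "dconst (sum f A) = (\<Sum>x\<in>A. dconst (f x))"
  by (induction A rule: infinite_finite_induct) (simp_all add: dconst_add)

lemma exp_dt_expand: "exp_dt B = mat 1 + scale_dt (B + scale_dt (exp_tail B))"
proof -
  have "fps_nth (exp_dt B $ i $ j) n =
      fps_nth ((mat 1 + scale_dt (B + scale_dt (exp_tail B))) $ i $ j) n" for i j n
  proof -
    have coeff: "fps_nth (exp_dt B $ i $ j) n =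
        (\<Sum>k\<le>n. dconst (1 / fact k) * fps_nth (matrix_pow B k $ i $ j) (n - k))"
      unfolding exp_dt_def scale_dt_def[symmetric]
      by (simp add: matrix_pow_scale_dt fps_X_power_mult_nth)
    have pow0: "fps_nth (matrix_pow B 0 $ i $ j) m = (if m = 0 \<and> i = j then 1 else 0)" for m
      by (simp add: matrix_pow_def mat_def)
    have pow1: "matrix_pow B (Suc 0) = B"
      by (simp add: matrix_pow_def)
    \<comment> \<open>Only the terms \<open>k \<le> 1\<close> reach degrees 0 and 1; in degree
      \<open>m + 2\<close> the terms \<open>k \<ge> 2\<close>, reindexed by two, form coefficient
      \<open>m\<close> of \<open>exp_tail\<close>.\<close>
    consider "n = 0" | "n = 1" | m where "n = Suc (Suc m)"
      by (metis One_nat_def not0_implies_Suc)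
    then show ?thesis
    proof cases
      case 1
      then show ?thesis
        unfolding coeff by (simp add: pow0 scale_dt_def mat_def)
    next
      case 2
      then show ?thesis
        unfolding coeff by (simp add: pow0 pow1 scale_dt_def mat_def)
    next
      case (3 m)
      then show ?thesis
        unfolding coeff
        by (simp add: pow0 pow1 scale_dt_def mat_def exp_tail_def sum.atMost_Suc_shift
            del: sum.atMost_Suc fact_Suc)
    qed
  qed
  then show ?thesis
    by (simp add: vec_eq_iff fps_eq_iff)
qed

lemma agree_exp_tail: "agree n A B \<Longrightarrow> agree n (exp_tail A) (exp_tail B)"
proof -
  assume "agree n A B"
  then have "agree n (matrix_pow A k) (matrix_pow B k)" for k
    by (rule agree_matrix_pow)
  then show ?thesis
    by (simp add: agree_def exp_tail_def)
qed

lemma exp_dt_eq_iff: "exp_dt B = mat 1 + scale_dt C \<longleftrightarrow> B + scale_dt (exp_tail B) = C"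
  by (simp add: exp_dt_expand scale_dt_inject)

text \<open>A formal logarithm without its series: solving the expanded exponential for its linear
  term gives \<open>A = scale_dt (exp_tail (- A)) - C\<close>, whose right-hand side is a
  contraction in \<open>A\<close>.\<close>

lemma exp_dt_log: "\<exists>!A. exp_dt (- A) = mat 1 + scale_dt C"
proof -
  have "\<exists>!A. A = scale_dt (exp_tail (- A)) - C"
    by (rule contraction_fixpoint)
      (intro agree_diff agree_scale_dt agree_exp_tail agree_uminus agree_refl)
  moreover have "exp_dt (- A) = mat 1 + scale_dt C \<longleftrightarrow> A = scale_dt (exp_tail (- A)) - C" for A
    unfolding exp_dt_eq_iff by (auto simp: algebra_simps)
  ultimately show ?thesis
    by simp
qed

section \<open>Constant matrices and values at \<Delta>t = 0\<close>

lemma fps_const_sum: "fps_const (sum f A) = (\<Sum>x\<in>A. fps_const (f x))"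
  by (simp add: fps_eq_iff fps_sum_nth)

lemma lift_matrix_mult: "lift_matrix (A ** B) = lift_matrix A ** lift_matrix B"
  by (simp add: lift_matrix_def matrix_matrix_mult_def vec_eq_iff dconst_sum dconst_mult
      fps_const_sum)

lemma lift_matrix_mat_1: "lift_matrix (mat 1) = mat 1"
  by (simp add: lift_matrix_def mat_def vec_eq_iff)

definition coeff0 :: "'a::comm_ring_1 fps^'m^'n \<Rightarrow> 'a^'m^'n" where
  "coeff0 A = (\<chi> i j. fps_nth (A $ i $ j) 0)"

lemma coeff0_mult: "coeff0 (A ** B) = coeff0 A ** coeff0 B"
  by (simp add: coeff0_def matrix_matrix_mult_def fps_sum_nth vec_eq_iff)

lemma coeff0_add: "coeff0 (A + B) = coeff0 A + coeff0 B"
  by (simp add: coeff0_def vec_eq_iff)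

lemma coeff0_uminus: "coeff0 (- A) = - coeff0 A"
  by (simp add: coeff0_def vec_eq_iff)

lemma coeff0_scale_dt [simp]: "coeff0 (scale_dt A) = 0"
  by (simp add: coeff0_def scale_dt_def vec_eq_iff)

section \<open>Block structure and the fixed point equation for \<Psi>\<close>

definition conserved_rows :: "'a^'m^(3 + ymom) \<Rightarrow> 'a^'m^3" where
  "conserved_rows A = (\<chi> i. A $ Inl i)"

text \<open>The block matrix \<open>(Id; E)\<close>, which will be the value of \<Psi> at \<Delta>t
  = 0.\<close>

definition equilibrium_moments :: "real \<Rightarrow> real^3^ymom \<Rightarrow> real^3^(3 + ymom)" where
  "equilibrium_moments lam e = (\<chi> k.
     case k of Inl i \<Rightarrow> mat 1 $ i | Inr y \<Rightarrow> equilibrium_matrix lam e $ y)"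

lemma sum_moments: "(\<Sum>k\<in>UNIV. f k) = (\<Sum>i\<in>UNIV. f (Inl i)) + (\<Sum>y\<in>UNIV. f (Inr y))"
  for f :: "'a::finite + 'b::finite \<Rightarrow> 'c::comm_monoid_add"
  by (subst UNIV_Plus_UNIV[symmetric]) (simp add: sum.Plus del: UNIV_Plus_UNIV)

lemma diag_mult_nth: "(diag d ** A) $ i $ j = d $ i * A $ i $ j"
  for A :: "'a::semiring_1^'m^'n"
  by (simp add: diag_def matrix_matrix_mult_def if_distrib if_distribR cong: if_cong)

lemma relaxation_conserved:
  "(lift_matrix (relaxation_matrix lam e s) ** \<Psi>) $ Inl i = \<Psi> $ Inl i"
  by (simp add: vec_eq_iff lift_matrix_def relaxation_matrix_def matrix_matrix_mult_def sum_moments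
      mat_def if_distrib if_distribR cong: if_cong)

text \<open>As \<open>S\<close> is diagonal and the conserved block of \<Psi> is the identity, both
  block sums collapse to a single term.\<close>

lemma relaxation_nonconserved:
  assumes "conserved_rows \<Psi> = mat 1"
  shows "(lift_matrix (relaxation_matrix lam e s) ** \<Psi>) $ Inr y $ j =
    fps_const (dconst (s $ y)) * lift_matrix (equilibrium_moments lam e) $ Inr y $ j +
    (1 - fps_const (dconst (s $ y))) * \<Psi> $ Inr y $ j"
proof -
  have top: "\<Psi> $ Inl i $ j = (if i = j then 1 else 0)" for i
    using assms by (simp add: vec_eq_iff conserved_rows_def mat_def)
  have block: "fps_const (dconst ((mat 1 - diag s) $ y $ z)) =
      (if y = z then 1 - fps_const (dconst (s $ y)) else 0)" for z
    by (simp add: mat_def diag_def dconst_diff fps_const_sub[symmetric] del: fps_const_sub)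
  have "(lift_matrix (relaxation_matrix lam e s) ** \<Psi>) $ Inr y $ j =
      (\<Sum>i\<in>UNIV. fps_const (dconst (s $ y * equilibrium_matrix lam e $ y $ i)) * \<Psi> $ Inl i $ j) +
      (\<Sum>z\<in>UNIV. fps_const (dconst ((mat 1 - diag s) $ y $ z)) * \<Psi> $ Inr z $ j)"
    by (simp add: lift_matrix_def relaxation_matrix_def matrix_matrix_mult_def[of _ \<Psi>]
        sum_moments diag_mult_nth)
  also have "\<dots> = fps_const (dconst (s $ y * equilibrium_matrix lam e $ y $ j)) +
      (1 - fps_const (dconst (s $ y))) * \<Psi> $ Inr y $ j"
    unfolding top block by (simp add: if_distrib if_distribR cong: if_cong)
  finally show ?thesis
    by (simp add: lift_matrix_def equilibrium_moments_def dconst_mult)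
qed

text \<open>The correction to \<open>(Id; E)\<close> after division by \<open>S\<close> and by
  \<Delta>t. Its conserved rows vanish because the conserved block of \<Psi> is the identity to all
  orders.\<close>

definition slope :: "real^ymom \<Rightarrow> dseries^(3 + ymom)^(3 + ymom) \<Rightarrow> dseries^3^(3 + ymom) \<Rightarrow>
    dseries^3^(3 + ymom)" where
  "slope s H \<Psi> = (\<chi> k j. case k of Inl i \<Rightarrow> 0 | Inr y \<Rightarrow>
     fps_const (dconst (1 / s $ y)) * (H ** \<Psi> - \<Psi> ** conserved_rows (H ** \<Psi>)) $ Inr y $ j)"

lemma agree_slope: "agree n A B \<Longrightarrow> agree n (slope s H A) (slope s H B)"
proof -
  assume AB: "agree n A B"
  then have "agree n (conserved_rows (H ** A)) (conserved_rows (H ** B))"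
    using agree_mult[OF agree_refl AB, of H] by (simp add: agree_def conserved_rows_def)
  then have "agree n (H ** A - A ** conserved_rows (H ** A)) (H ** B - B ** conserved_rows (H ** B))"
    by (intro agree_diff agree_mult agree_refl AB)
  then show ?thesis
    by (simp add: agree_def slope_def split: sum.split)
qed

text \<open>Relaxation keeps the conserved block, which is the identity in \<Psi>, so the conserved
  rows determine \<open>P\<close>, which stands for the exponential of
  \<open>- \<Delta>t \<A>\<close>. With this \<open>P\<close> the other rows \<open>Y\<close> of
  \<Psi> satisfy \<open>S Y = S E + \<Delta>t (H \<Psi> - \<Psi> Q)\<close>, which is then divided
  by \<open>S\<close>.\<close>

lemma equivalent_pair_iff_fixpoint:
  assumes s: "\<And>k. s $ k \<noteq> 0"
  shows "(\<forall>i. \<Psi> $ Inl i = mat 1 $ i) \<and>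
      (lift_matrix (relaxation_matrix lam e s) + scale_dt H) ** \<Psi> = \<Psi> ** P \<longleftrightarrow>
    \<Psi> = lift_matrix (equilibrium_moments lam e) + scale_dt (slope s H \<Psi>) \<and>
    P = mat 1 + scale_dt (conserved_rows (H ** \<Psi>))"
    (is "?top \<and> ?eq \<longleftrightarrow> ?fix \<and> ?P")
proof -
  let ?J = "lift_matrix (relaxation_matrix lam e s)"
  let ?E = "lift_matrix (equilibrium_moments lam e)"
  define Q where "Q = conserved_rows (H ** \<Psi>)"
  \<comment> \<open>The fixed point equation contains the normalization of \<Psi>, as
    \<open>slope\<close> is 0 on the conserved rows.\<close>
  have top_of_fix: ?top if ?fix
  proof -
    have "\<Psi> $ Inl i $ j = ?E $ Inl i $ j + scale_dt (slope s H \<Psi>) $ Inl i $ j" for i j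
      by (subst that) simp
    then show ?thesis
      by (simp add: vec_eq_iff scale_dt_def slope_def lift_matrix_def equilibrium_moments_def
          mat_def)
  qed
  have *: "?eq \<longleftrightarrow> ?fix \<and> ?P" if ?top
  proof -
    have top: "conserved_rows \<Psi> = mat 1"
      using that by (simp add: conserved_rows_def vec_eq_iff)
    have top_mult: "(\<Psi> ** B) $ Inl i = B $ i" for B :: "dseries^3^3" and i
    proof -
      have "(\<Psi> ** B) $ Inl i = (mat 1 ** B) $ i"
        using that by (simp add: matrix_matrix_mult_def)
      then show ?thesis
        by simp
    qed
    have split: "?eq \<longleftrightarrow> (\<forall>i. ((?J + scale_dt H) ** \<Psi>) $ Inl i = (\<Psi> ** P) $ Inl i) \<and>
        (\<forall>y. ((?J + scale_dt H) ** \<Psi>) $ Inr y = (\<Psi> ** P) $ Inr y)"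
      unfolding vec_eq_iff[of "(?J + scale_dt H) ** \<Psi>"] by (metis sumE)
    have LHS: "(?J + scale_dt H) ** \<Psi> = ?J ** \<Psi> + scale_dt (H ** \<Psi>)"
      by (simp add: matrix_add_rdistrib scale_dt_mult_left)
    have eqP: "(\<forall>i. ((?J + scale_dt H) ** \<Psi>) $ Inl i = (\<Psi> ** P) $ Inl i) \<longleftrightarrow> ?P"
      unfolding LHS using that
      by (auto simp: top_mult relaxation_conserved vec_eq_iff scale_dt_def conserved_rows_def)
    have eqY: "(\<forall>y. ((?J + scale_dt H) ** \<Psi>) $ Inr y = (\<Psi> ** P) $ Inr y) \<longleftrightarrow> ?fix" if ?P
    proof -
      have RHS: "\<Psi> ** P = \<Psi> + scale_dt (\<Psi> ** Q)"
        using that by (simp add: matrix_add_ldistrib scale_dt_mult_right Q_def)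
      have entry: "((?J + scale_dt H) ** \<Psi>) $ Inr y $ j = (\<Psi> ** P) $ Inr y $ j \<longleftrightarrow>
          \<Psi> $ Inr y $ j = (?E + scale_dt (slope s H \<Psi>)) $ Inr y $ j" for y j
      proof -
        define c where "c = fps_const (dconst (s $ y))"
        define d where "d = fps_const (dconst (1 / s $ y))"
        have cd: "d * c = 1"
          using s[of y] by (simp add: c_def d_def dconst_mult[symmetric])
        have "((?J + scale_dt H) ** \<Psi>) $ Inr y $ j = (\<Psi> ** P) $ Inr y $ j \<longleftrightarrow>
          c * \<Psi> $ Inr y $ j = c * ?E $ Inr y $ j + fps_X * (H ** \<Psi> - \<Psi> ** Q) $ Inr y $ j"
          unfolding LHS RHS
          by (auto simp: relaxation_nonconserved[OF top] scale_dt_def c_def[symmetric]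
              algebra_simps)
        also have "\<dots> \<longleftrightarrow>
          \<Psi> $ Inr y $ j = ?E $ Inr y $ j + d * (fps_X * (H ** \<Psi> - \<Psi> ** Q) $ Inr y $ j)"
          (is "c * ?x = c * ?y + ?z \<longleftrightarrow> _")
        proof
          assume "c * ?x = c * ?y + ?z"
          then have "d * (c * ?x) = d * (c * ?y + ?z)"
            by simp
          then show "?x = ?y + d * ?z"
            by (simp add: distrib_left mult.assoc[symmetric] cd)
        next
          assume "?x = ?y + d * ?z"
          then show "c * ?x = c * ?y + ?z"
            by (simp only: distrib_left mult.assoc[symmetric] cd mult.commute[of c d] mult_1)
        qed
        finally show ?thesis
          by (simp add: scale_dt_def slope_def Q_def d_def mult.left_commute)
      qed
      have "?fix \<longleftrightarrow> (\<forall>i. \<Psi> $ Inl i = (?E + scale_dt (slope s H \<Psi>)) $ Inl i) \<and>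
          (\<forall>y. \<Psi> $ Inr y = (?E + scale_dt (slope s H \<Psi>)) $ Inr y)"
        unfolding vec_eq_iff[of \<Psi>] by (metis sumE)
      moreover have "\<Psi> $ Inl i = (?E + scale_dt (slope s H \<Psi>)) $ Inl i" for i
        using \<open>?top\<close>
        by (simp add: vec_eq_iff scale_dt_def slope_def lift_matrix_def equilibrium_moments_def
            mat_def)
      ultimately show ?thesis
        using entry by (simp add: vec_eq_iff)
    qed
    show ?thesis
      using split eqP eqY by blast
  qed
  show ?thesis
    using * top_of_fix by blast
qed

section \<open>The equivalent operator at \<Delta>t = 0\<close>

text \<open>At \<Delta>t = 0 the logarithm reduces to its linear term, \<Psi> to
  \<open>(Id; E)\<close>, and \<open>H\<close> to \<open>- M \<Lambda> M^{-1} J\<close>, where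
  \<open>J\<close> leaves \<open>(Id; E)\<close> unchanged.\<close>

lemma equivalent_operator_coeff0:
  assumes s: "\<And>k. s $ k \<noteq> 0"
    and inv: "moment_matrix lam ** matrix_inv (moment_matrix lam) = mat 1"
  shows "coeff0 (equivalent_operator lam e s) = conserved_rows
    (coeff0 (lift_matrix (moment_matrix lam) ** advection lam **
      lift_matrix (matrix_inv (moment_matrix lam) ** equilibrium_moments lam e)))"
proof -
  let ?M = "lift_matrix (moment_matrix lam)"
  let ?N = "lift_matrix (matrix_inv (moment_matrix lam))"
  let ?J = "lift_matrix (relaxation_matrix lam e s)"
  let ?E = "lift_matrix (equilibrium_moments lam e)"
  let ?L = "advection lam"
  \<comment> \<open>The one-step operator minus \<open>J\<close>, divided by \<Delta>t.\<close>
  define H where "H = ?M ** (- ?L + scale_dt (exp_tail (- ?L))) ** ?N ** ?J"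
  have "?M ** ?N = mat 1"
    by (simp add: lift_matrix_mult[symmetric] inv lift_matrix_mat_1)
  then have G: "?M ** exp_dt (- ?L) ** ?N ** ?J = ?J + scale_dt H"
    by (simp add: exp_dt_expand[of "- ?L"] H_def matrix_add_ldistrib matrix_add_rdistrib
        scale_dt_mult_left scale_dt_mult_right scale_dt_add)
  have "\<exists>!\<Psi>. \<Psi> = ?E + scale_dt (slope s H \<Psi>)"
    by (rule contraction_fixpoint) (intro agree_add agree_scale_dt agree_slope agree_refl)
  then obtain \<Psi> where \<Psi>: "\<Psi> = ?E + scale_dt (slope s H \<Psi>)"
    and \<Psi>_unique: "\<And>\<Psi>'. \<Psi>' = ?E + scale_dt (slope s H \<Psi>') \<Longrightarrow> \<Psi>' = \<Psi>"
    by blast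
  have "\<exists>!A. exp_dt (- A) = mat 1 + scale_dt (conserved_rows (H ** \<Psi>))"
    by (rule exp_dt_log)
  then obtain A where A: "exp_dt (- A) = mat 1 + scale_dt (conserved_rows (H ** \<Psi>))"
    and A_unique: "\<And>A'. exp_dt (- A') = mat 1 + scale_dt (conserved_rows (H ** \<Psi>)) \<Longrightarrow> A' = A"
    by blast
  have pair: "equivalent_pair lam e s \<Psi>' A' \<longleftrightarrow> \<Psi>' = ?E + scale_dt (slope s H \<Psi>') \<and>
      exp_dt (- A') = mat 1 + scale_dt (conserved_rows (H ** \<Psi>'))" for \<Psi>' A'
    unfolding equivalent_pair_def G by (rule equivalent_pair_iff_fixpoint[OF s])
  \<comment> \<open>The equation for \<Psi> does not involve \<open>A\<close>, and \<open>A\<close>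
    comes from the logarithm of a matrix built from \<Psi>; uniqueness in both stages resolves the
    \<open>THE\<close>.\<close>
  have op: "equivalent_operator lam e s = A"
    unfolding equivalent_operator_def
  proof (rule the_equality)
    show "\<exists>\<Psi>. equivalent_pair lam e s \<Psi> A"
      using pair \<Psi> A by blast
    show "A' = A" if "\<exists>\<Psi>. equivalent_pair lam e s \<Psi> A'" for A'
      using that pair \<Psi>_unique A_unique by blast
  qed
  have "- A + scale_dt (exp_tail (- A)) = conserved_rows (H ** \<Psi>)"
    using A exp_dt_eq_iff by blast
  then have "coeff0 (- A + scale_dt (exp_tail (- A))) = coeff0 (conserved_rows (H ** \<Psi>))"
    by simp
  then have coeff0_A: "- coeff0 A = conserved_rows (coeff0 (H ** \<Psi>))"
    unfolding coeff0_add coeff0_uminus coeff0_scale_dt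
    by (simp add: coeff0_def conserved_rows_def vec_eq_iff)
  \<comment> \<open>An equilibrium is not changed by relaxation:
    \<open>S E + (Id - S) E = E\<close>.\<close>
  have JE: "?J ** ?E = ?E"
  proof -
    have top: "conserved_rows ?E = mat 1"
      by (simp add: conserved_rows_def lift_matrix_def equilibrium_moments_def mat_def vec_eq_iff)
    have "(?J ** ?E) $ k $ j = ?E $ k $ j" for k j
      by (cases k) (simp_all add: relaxation_conserved relaxation_nonconserved[OF top]
          algebra_simps)
    then show ?thesis
      by (simp add: vec_eq_iff)
  qed
  have "coeff0 \<Psi> = coeff0 ?E"
    by (subst \<Psi>) (simp add: coeff0_add)
  then have "coeff0 (H ** \<Psi>) = coeff0 (H ** ?E)"
    by (simp add: coeff0_mult)
  also have "H ** ?E = ?M ** (- ?L + scale_dt (exp_tail (- ?L))) ** ?N ** ?E"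
    unfolding H_def by (simp add: matrix_mul_assoc[symmetric] JE)
  also have "coeff0 \<dots> = coeff0 ?M ** (- coeff0 ?L) ** coeff0 (?N ** ?E)"
    unfolding coeff0_mult coeff0_add coeff0_uminus coeff0_scale_dt
    by (simp add: matrix_mul_assoc)
  also have "\<dots> = - coeff0 (?M ** ?L ** (?N ** ?E))"
    by (simp add: coeff0_mult) (simp add: matrix_matrix_mult_def vec_eq_iff sum_negf)
  finally have "- coeff0 (equivalent_operator lam e s) =
      conserved_rows (- coeff0 (?M ** ?L ** (?N ** ?E)))"
    using coeff0_A op by simp
  then show ?thesis
    by (simp add: lift_matrix_mult conserved_rows_def vec_eq_iff)
qed

section \<open>Invertibility of the moment matrix\<close>

text \<open>The polynomials are homogeneous in \<open>lam\<close> and \<open>v\<close> jointly,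
  which reduces the kernel computation to numerical coefficients.\<close>

lemma ymom_poly_homogeneous:
  "ymom_poly y lam (lam *\<^sub>R v) = lam ^ ymom_degree y * ymom_poly y 1 v"
  by (cases y) (simp_all add: field_simps eval_nat_numeral)

lemma sum_vel: "(\<Sum>j\<in>UNIV. f j) = f V0 + f E1 + f W1 + f N1 + f S1 + f NE1 + f NW1 + f SW1 + f SE1 +
    f E2 + f W2 + f N2 + f S2"
  for f :: "vel \<Rightarrow> 'a::comm_monoid_add"
  by (simp add: UNIV_vel add_ac)

lemma moment_matrix_kernel:
  assumes "lam > 0" and x: "moment_matrix lam *v x = 0"
  shows "x = 0"
proof -
  have cons: "(\<Sum>j\<in>UNIV. cons_poly i (velocity lam j) * x $ j) = 0" for i
    using arg_cong[OF x, of "\<lambda>u. u $ Inl i"]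
    by (simp add: matrix_vector_mult_def moment_matrix_def)
  have c1: "(\<Sum>j\<in>UNIV. x $ j) = 0"
    using cons[of 1] by (simp add: cons_poly_def)
  have "lam * (\<Sum>j\<in>UNIV. vel_dir j $ 1 * x $ j) = 0" "lam * (\<Sum>j\<in>UNIV. vel_dir j $ 2 * x $ j) = 0"
    using cons[of 2] cons[of 3]
    by (simp_all add: cons_poly_def velocity_def sum_distrib_left mult.assoc)
  then have c2: "(\<Sum>j\<in>UNIV. vel_dir j $ 1 * x $ j) = 0" and c3: "(\<Sum>j\<in>UNIV. vel_dir j $ 2 * x $ j) = 0"
    using \<open>lam > 0\<close> by simp_all
  have Y: "(\<Sum>j\<in>UNIV. ymom_poly y 1 (vel_dir j) * x $ j) = 0" for y
  proof -
    have "lam ^ ymom_degree y * (\<Sum>j\<in>UNIV. ymom_poly y 1 (vel_dir j) * x $ j) = 0"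
      using arg_cong[OF x, of "\<lambda>u. u $ Inr y"]
      by (simp add: matrix_vector_mult_def moment_matrix_def velocity_def
          ymom_poly_homogeneous sum_distrib_left mult.assoc)
    then show ?thesis
      using \<open>lam > 0\<close> by simp
  qed
  \<comment> \<open>The orthogonalized rows span the functions of \<open>|v|\<close> and the products of such functions with
    \<open>v\<^sub>x\<close>, \<open>v\<^sub>y\<close>, \<open>v\<^sub>x\<^sup>2 - v\<^sub>y\<^sup>2\<close> and \<open>v\<^sub>x v\<^sub>y\<close>, so the system splits by symmetry class and by shell of
    equal \<open>|v|\<close>.\<close>
  have radial: "x $ V0 = 0" "x $ E1 + x $ W1 + x $ N1 + x $ S1 = 0"
    "x $ NE1 + x $ NW1 + x $ SW1 + x $ SE1 = 0" "x $ E2 + x $ W2 + x $ N2 + x $ S2 = 0"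
    using c1 Y[of MEps] Y[of MEps2] Y[of MEps3]
    by (simp_all add: sum_vel)
  have x_odd: "x $ E1 - x $ W1 = 0" "x $ NE1 - x $ NW1 - x $ SW1 + x $ SE1 = 0" "x $ E2 - x $ W2 = 0"
    using c2 Y[of MPhiX] Y[of MXEps2]
    by (simp_all add: sum_vel)
  have y_odd: "x $ N1 - x $ S1 = 0" "x $ NE1 + x $ NW1 - x $ SW1 - x $ SE1 = 0" "x $ N2 - x $ S2 = 0"
    using c3 Y[of MPhiY] Y[of MYEps2]
    by (simp_all add: sum_vel)
  have xx: "x $ E1 + x $ W1 - x $ N1 - x $ S1 = 0" "x $ E2 + x $ W2 - x $ N2 - x $ S2 = 0"
    using Y[of MPhiXX] Y[of MXXEps]
    by (simp_all add: sum_vel)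
  have xy: "x $ NE1 - x $ NW1 + x $ SW1 - x $ SE1 = 0"
    using Y[of MPhiXY] by (simp add: sum_vel)
  have "x $ j = 0" for j
    by (cases j; simp only:; use radial x_odd y_odd xx xy in linarith)
  then show ?thesis
    by (simp add: vec_eq_iff)
qed

text \<open>Rows and columns have different index types, so injectivity gives only a left inverse.
  The count 13 = 3 + 10 makes the map surjective, which gives a right inverse; the two coincide, so
  the choice in \<open>matrix_inv\<close> has a witness.\<close>

lemma moment_matrix_inv:
  assumes "lam > 0"
  shows "moment_matrix lam ** matrix_inv (moment_matrix lam) = mat 1"
proof -
  let ?M = "moment_matrix lam"
  have inj: "inj ((*v) ?M)"
    using moment_matrix_kernel[OF assms] matrix_left_invertible_ker matrix_left_invertible_injective
    by metis
  then obtain B where B: "B ** ?M = mat 1"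
    using matrix_left_invertible_injective by blast
  have "CARD(vel) = 13" "CARD(ymom) = 10"
    by (simp_all add: UNIV_vel UNIV_ymom)
  then have "dim (range ((*v) ?M)) = DIM(real^(3 + ymom))"
    using dim_image_eq[OF matrix_vector_mul_linear, of ?M UNIV] inj
    by simp
  then have "surj ((*v) ?M)"
    using dim_eq_full linear_subspace_image[OF matrix_vector_mul_linear subspace_UNIV, of ?M]
    by (metis span_eq_iff)
  then obtain C where C: "?M ** C = mat 1"
    using matrix_right_invertible_surjective by blast
  have "B = C"
    by (metis B C matrix_mul_assoc matrix_mul_lid matrix_mul_rid)
  with B C show ?thesis
    unfolding matrix_inv_def by (metis (mono_tags, lifting) someI_ex)
qed

section \<open>The first-order tensor as an equilibrium flux\<close>

text \<open>The flux in direction \<open>a\<close> of the conserved moment \<open>i\<close>, for the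
  equilibrium distribution whose conserved moments are the \<open>k\<close>-th unit vector.\<close>

definition euler_flux :: "real \<Rightarrow> real^3^ymom \<Rightarrow> 2 \<Rightarrow> real^3^3" where
  "euler_flux lam e a = (\<chi> i k. \<Sum>j\<in>UNIV. cons_poly i (velocity lam j) * velocity lam j $ a *
     (matrix_inv (moment_matrix lam) ** equilibrium_moments lam e) $ j $ k)"

lemma equivalent_operator_order_1:
  assumes "lam > 0" "\<And>k. s $ k \<noteq> 0"
  shows "fps_nth (equivalent_operator lam e s $ i $ k) 0 =
    (\<Sum>a\<in>UNIV. dconst (euler_flux lam e a $ i $ k) * partial a)"
proof -
  define F where "F = matrix_inv (moment_matrix lam) ** equilibrium_moments lam e"
  have lift: "coeff0 (lift_matrix A) = (\<chi> i j. dconst (A $ i $ j))" for A :: "real^'m^'n"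
    by (simp add: coeff0_def lift_matrix_def vec_eq_iff)
  have adv: "coeff0 (advection lam) =
      diag (\<chi> j. \<Sum>a\<in>UNIV. dconst (velocity lam j $ a) * partial a)"
    by (simp add: coeff0_def advection_def diag_def vec_eq_iff)
  have "fps_nth (equivalent_operator lam e s $ i $ k) 0 =
      coeff0 (lift_matrix (moment_matrix lam) ** (advection lam ** lift_matrix F)) $ Inl i $ k"
    unfolding F_def matrix_mul_assoc
    using arg_cong[OF equivalent_operator_coeff0[OF assms(2) moment_matrix_inv[OF assms(1)], of e],
        of "\<lambda>A. A $ i $ k"]
    by (simp add: conserved_rows_def) (simp add: coeff0_def)
  also have "\<dots> = (\<Sum>j\<in>UNIV. dconst (cons_poly i (velocity lam j)) *
      ((\<Sum>a\<in>UNIV. dconst (velocity lam j $ a) * partial a) * dconst (F $ j $ k)))"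
    unfolding coeff0_mult lift adv
    by (simp add: matrix_matrix_mult_def[of "\<chi> i j. _ i j"] diag_mult_nth moment_matrix_def)
  also have "\<dots> = (\<Sum>a\<in>UNIV. dconst (euler_flux lam e a $ i $ k) * partial a)"
    by (simp add: euler_flux_def F_def[symmetric] sum_2 dconst_sum dconst_mult sum_distrib_left
        sum_distrib_right sum.distrib[symmetric] algebra_simps)
  finally show ?thesis .
qed

lemma sum_length_1: "(\<Sum>\<alpha> | length \<alpha> = Suc 0. f \<alpha>) = (\<Sum>a\<in>UNIV. f [a])"
  for f :: "'a::finite list \<Rightarrow> 'b::comm_monoid_add"
proof -
  have "{\<alpha>::'a list. length \<alpha> = Suc 0} = range (\<lambda>a. [a])"
    by (auto simp: length_Suc_conv)
  then show ?thesis
    by (simp add: sum.reindex inj_on_def)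
qed

text \<open>A normal form from which both coefficients can be read off, so that equal first-order
  operators have equal coefficients.\<close>

lemma first_order_symbol: "(\<Sum>a\<in>UNIV. dconst (c a) * partial a) = [:[:0, c 2:], [:c 1:]:]"
  by (simp add: sum_2 dconst_def partial_def)

text \<open>On singleton lists symmetry is vacuous and the operator fixes each value; on all other
  lists the value is 0. Hence the \<open>THE\<close> has exactly one candidate.\<close>

lemma equivalent_tensor_1:
  assumes "lam > 0" "\<And>k. s $ k \<noteq> 0"
  shows "equivalent_tensor lam e s 1 =
    (\<lambda>\<alpha>. if length \<alpha> = 1 then euler_flux lam e (hd \<alpha>) else 0)" (is "_ = ?T")
proof -
  have contract: "nabla_contract 1 T =
      (\<chi> i j. fps_nth (equivalent_operator lam e s $ i $ j) (1 - 1)) \<longleftrightarrow>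
      (\<forall>a. T [a] = euler_flux lam e a)" for T
    by (auto simp: nabla_contract_def sum_length_1 equivalent_operator_order_1[OF assms]
        first_order_symbol vec_eq_iff forall_2)
  show ?thesis
    unfolding equivalent_tensor_def contract
  proof (rule the_equality)
    have perm: "?T \<alpha> = ?T \<beta>" if "mset \<alpha> = mset \<beta>" for \<alpha> \<beta>
      using that mset_eq_length[OF that] by (auto simp: length_Suc_conv)
    show "symmetric_tensor 1 ?T \<and> (\<forall>a. ?T [a] = euler_flux lam e a)"
      unfolding symmetric_tensor_def by (intro conjI allI impI; (rule perm)?) simp_all
  next
    fix T
    assume "symmetric_tensor 1 T \<and> (\<forall>a. T [a] = euler_flux lam e a)"
    then have T: "length \<alpha> \<noteq> 1 \<Longrightarrow> T \<alpha> = 0" "T [a] = euler_flux lam e a" for \<alpha> a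
      unfolding symmetric_tensor_def by blast+
    show "T = ?T"
    proof
      fix \<alpha> :: "2 list"
      show "T \<alpha> = ?T \<alpha>"
        by (cases "length \<alpha> = 1") (auto simp: T length_Suc_conv)
    qed
  qed
qed

text \<open>Products of two velocity components are combinations of rows of \<open>M\<close>:
  \<open>|v|^2\<close> is the energy polynomial plus \<open>28 * lam^2\<close>, divided by 13, and
  the two squares are half of \<open>|v|^2\<close> plus or minus the \<open>MPhiXX\<close>
  polynomial.\<close>

lemma euler_flux_simps:
  assumes "lam > 0"
  shows "euler_flux lam e 1 $ 1 $ k = mat 1 $ 2 $ k"
    and "euler_flux lam e 2 $ 1 $ k = mat 1 $ 3 $ k"
    and "euler_flux lam e 1 $ 2 $ k = (equilibrium_matrix lam e $ MEps $ k +
      28 * lam^2 * mat 1 $ 1 $ k) / 26 + equilibrium_matrix lam e $ MPhiXX $ k / 2"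
    and "euler_flux lam e 2 $ 3 $ k = (equilibrium_matrix lam e $ MEps $ k +
      28 * lam^2 * mat 1 $ 1 $ k) / 26 - equilibrium_matrix lam e $ MPhiXX $ k / 2"
    and "euler_flux lam e 1 $ 3 $ k = equilibrium_matrix lam e $ MPhiXY $ k"
    and "euler_flux lam e 2 $ 2 $ k = equilibrium_matrix lam e $ MPhiXY $ k"
proof -
  define F where "F = matrix_inv (moment_matrix lam) ** equilibrium_moments lam e"
  have MF: "moment_matrix lam ** F = equilibrium_moments lam e"
    by (simp add: F_def matrix_mul_assoc moment_matrix_inv[OF assms])
  have cons: "(\<Sum>j\<in>UNIV. cons_poly i (velocity lam j) * F $ j $ k) = mat 1 $ i $ k" for i
    using arg_cong[OF MF, of "\<lambda>A. A $ Inl i $ k"]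
    by (simp add: matrix_matrix_mult_def moment_matrix_def equilibrium_moments_def)
  have noncons: "(\<Sum>j\<in>UNIV. ymom_poly y lam (velocity lam j) * F $ j $ k) =
      equilibrium_matrix lam e $ y $ k" for y
    using arg_cong[OF MF, of "\<lambda>A. A $ Inr y $ k"]
    by (simp add: matrix_matrix_mult_def moment_matrix_def equilibrium_moments_def)
  show "euler_flux lam e 1 $ 1 $ k = mat 1 $ 2 $ k" "euler_flux lam e 2 $ 1 $ k = mat 1 $ 3 $ k"
    using cons[of 2] cons[of 3] by (simp_all add: euler_flux_def F_def[symmetric] cons_poly_def)
  show "euler_flux lam e 1 $ 3 $ k = equilibrium_matrix lam e $ MPhiXY $ k"
    "euler_flux lam e 2 $ 2 $ k = equilibrium_matrix lam e $ MPhiXY $ k"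
    using noncons[of MPhiXY]
    by (simp_all add: euler_flux_def F_def[symmetric] cons_poly_def mult.commute)
  \<comment> \<open>The weight \<open>c = 1 / 2\<close> produces the square of the first velocity
    component, \<open>c = - 1 / 2\<close> that of the second.\<close>
  let ?rhs = "\<lambda>c. ((\<Sum>j\<in>UNIV. ymom_poly MEps lam (velocity lam j) * F $ j $ k) +
      28 * lam^2 * (\<Sum>j\<in>UNIV. cons_poly 1 (velocity lam j) * F $ j $ k)) / 26 +
      c * (\<Sum>j\<in>UNIV. ymom_poly MPhiXX lam (velocity lam j) * F $ j $ k)"
  have combine: "?rhs c = (\<Sum>j\<in>UNIV. ((ymom_poly MEps lam (velocity lam j) + 28 * lam^2) / 26 +
      c * ymom_poly MPhiXX lam (velocity lam j)) * F $ j $ k)" for c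
    unfolding sum_distrib_left sum.distrib[symmetric] sum_divide_distrib
    by (rule sum.cong) (simp_all add: cons_poly_def field_simps)
  have "euler_flux lam e 1 $ 2 $ k = ?rhs (1 / 2)"
    unfolding combine euler_flux_def F_def[symmetric] vec_lambda_beta
    by (rule sum.cong) (simp_all add: cons_poly_def field_simps power2_eq_square)
  then show "euler_flux lam e 1 $ 2 $ k = (equilibrium_matrix lam e $ MEps $ k +
      28 * lam^2 * mat 1 $ 1 $ k) / 26 + equilibrium_matrix lam e $ MPhiXX $ k / 2"
    unfolding cons noncons by simp
  have "euler_flux lam e 2 $ 3 $ k = ?rhs (- 1 / 2)"
    unfolding combine euler_flux_def F_def[symmetric] vec_lambda_beta
    by (rule sum.cong) (simp_all add: cons_poly_def field_simps power2_eq_square)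
  then show "euler_flux lam e 2 $ 3 $ k = (equilibrium_matrix lam e $ MEps $ k +
      28 * lam^2 * mat 1 $ 1 $ k) / 26 - equilibrium_matrix lam e $ MPhiXX $ k / 2"
    unfolding cons noncons by simp
qed

section \<open>Plane rotations and invariance of the flux\<close>

lemma SO2_cases:
  assumes "r \<in> SO2"
  obtains c d where "c^2 + d^2 = 1" "r = vector [vector [c, - d], vector [d, c]]"
proof -
  have det: "r $ 1 $ 1 * r $ 2 $ 2 - r $ 1 $ 2 * r $ 2 $ 1 = 1"
    using assms by (simp add: SO2_def det_2)
  have orth: "r ** transpose r = mat 1"
    using assms by (simp add: SO2_def orthogonal_matrix_def)
  have row1: "(r $ 1 $ 1)^2 + (r $ 1 $ 2)^2 = 1"
    using arg_cong[OF orth, of "\<lambda>A. A $ 1 $ 1"]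
    by (simp add: matrix_matrix_mult_def transpose_def sum_2 mat_def power2_eq_square)
  have row2: "(r $ 2 $ 1)^2 + (r $ 2 $ 2)^2 = 1"
    using arg_cong[OF orth, of "\<lambda>A. A $ 2 $ 2"]
    by (simp add: matrix_matrix_mult_def transpose_def sum_2 mat_def power2_eq_square)
  \<comment> \<open>The left-hand side is the sum of the two squared row norms minus twice the
    determinant.\<close>
  have "(r $ 1 $ 1 - r $ 2 $ 2)^2 + (r $ 1 $ 2 + r $ 2 $ 1)^2 = 0"
    using det row1 row2 by (simp add: power2_eq_square algebra_simps)
  then have "r $ 2 $ 2 = r $ 1 $ 1" "r $ 1 $ 2 = - r $ 2 $ 1"
    by (simp_all add: sum_power2_eq_zero_iff)
  then show thesis
    using row1 by (intro that[of "r $ 1 $ 1" "r $ 2 $ 1"]) (simp_all add: vec_eq_iff forall_2)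
qed

lemma rotation_in_SO2:
  assumes "c^2 + d^2 = 1"
  shows "vector [vector [c, - d], vector [d, c]] \<in> SO2"
  using assms
  by (simp add: SO2_def orthogonal_matrix det_2 matrix_matrix_mult_def transpose_def sum_2 mat_def
      vec_eq_iff forall_2 power2_eq_square algebra_simps)

lemma matrix_inv_rot3:
  assumes "c^2 + d^2 = 1"
  shows "matrix_inv (rot3 (vector [vector [c, - d], vector [d, c]])) =
    rot3 (vector [vector [c, d], vector [- d, c]])"
proof -
  let ?R = "rot3 (vector [vector [c, - d], vector [d, c]])"
  let ?R' = "rot3 (vector [vector [c, d], vector [- d, c]])"
  have R: "?R ** ?R' = mat 1"
    using assms
    by (simp add: rot3_def matrix_matrix_mult_def sum_3 mat_def vec_eq_iff forall_3
        power2_eq_square algebra_simps)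
  then have R': "?R' ** ?R = mat 1"
    by (rule matrix_left_right_inverse1)
  with R have "?R ** matrix_inv ?R = mat 1"
    unfolding matrix_inv_def by (metis (mono_tags, lifting) someI_ex)
  then have "?R' ** ?R ** matrix_inv ?R = ?R'"
    by (simp add: matrix_mul_assoc[symmetric])
  then show ?thesis
    by (simp add: R')
qed

lemma tensor_action_1:
  "tensor_action 1 r (\<lambda>\<alpha>. if length \<alpha> = 1 then T (hd \<alpha>) else 0) =
     (\<lambda>\<alpha>. if length \<alpha> = 1 then T (hd \<alpha>) else 0) \<longleftrightarrow>
   (\<forall>a i j. (\<Sum>b\<in>UNIV. \<Sum>k\<in>UNIV. \<Sum>l\<in>UNIV.
      rot3 r $ i $ l * T b $ l $ k * r $ a $ b * matrix_inv (rot3 r) $ k $ j) = T a $ i $ j)"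
    (is "?l \<longleftrightarrow> ?r")
proof
  assume ?l
  show ?r
  proof (intro allI)
    fix a i j
    show "(\<Sum>b\<in>UNIV. \<Sum>k\<in>UNIV. \<Sum>l\<in>UNIV.
      rot3 r $ i $ l * T b $ l $ k * r $ a $ b * matrix_inv (rot3 r) $ k $ j) = T a $ i $ j"
      using arg_cong[OF fun_cong[OF \<open>?l\<close>, of "[a]"], of "\<lambda>A. A $ i $ j"]
      by (simp add: tensor_action_def sum_length_1)
  qed
next
  assume r: ?r
  show ?l
  proof
    fix \<alpha> :: "2 list"
    show "tensor_action 1 r (\<lambda>\<alpha>. if length \<alpha> = 1 then T (hd \<alpha>) else 0) \<alpha> =
        (if length \<alpha> = 1 then T (hd \<alpha>) else 0)"
    proof (cases "length \<alpha> = 1")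
      case True
      then obtain a where "\<alpha> = [a]"
        by (auto simp: length_Suc_conv)
      with r show ?thesis
        by (simp add: tensor_action_def sum_length_1 vec_eq_iff)
    qed (simp add: tensor_action_def)
  qed
qed

text \<open>The density flux is the momentum, hence already invariant, so only the momentum flux is
  constrained: its density column must be a scalar matrix, and its momentum columns must
  vanish.\<close>

lemma isotropic_1_iff_euler_flux:
  fixes lam :: real and e :: "real^3^ymom" and s :: "real^ymom"
  assumes lam: "lam > 0" and s: "\<And>k. s $ k \<noteq> 0"
  defines "T \<equiv> euler_flux lam e"
  shows "isotropic_at_order lam e s 1 \<longleftrightarrow>
    T 1 $ 2 $ 1 = T 2 $ 3 $ 1 \<and> T 1 $ 3 $ 1 = 0 \<and>
    T 1 $ 2 $ 2 = 0 \<and> T 1 $ 2 $ 3 = 0 \<and> T 1 $ 3 $ 2 = 0 \<and> T 1 $ 3 $ 3 = 0 \<and>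
    T 2 $ 3 $ 2 = 0 \<and> T 2 $ 3 $ 3 = 0" (is "_ \<longleftrightarrow> ?cond")
proof -
  have row1: "T 1 $ 1 $ 1 = 0" "T 1 $ 1 $ 2 = 1" "T 1 $ 1 $ 3 = 0"
    "T 2 $ 1 $ 1 = 0" "T 2 $ 1 $ 2 = 0" "T 2 $ 1 $ 3 = 1"
    by (simp_all add: T_def euler_flux_simps[OF lam] mat_def)
  have cross: "T 2 $ 2 $ k = T 1 $ 3 $ k" for k
    by (simp add: T_def euler_flux_simps[OF lam])
  define inv where "inv r \<longleftrightarrow> (\<forall>a i j. (\<Sum>b\<in>UNIV. \<Sum>k\<in>UNIV. \<Sum>l\<in>UNIV.
      rot3 r $ i $ l * T b $ l $ k * r $ a $ b * matrix_inv (rot3 r) $ k $ j) = T a $ i $ j)" for r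
  have iso: "isotropic_at_order lam e s 1 \<longleftrightarrow> (\<forall>r\<in>SO2. inv r)"
    unfolding inv_def tensor_action_1[symmetric] T_def equivalent_tensor_1[OF lam s, symmetric]
    by (simp add: isotropic_at_order_def)
  have inv_rot: "inv (vector [vector [c, - d], vector [d, c]]) \<longleftrightarrow>
      (\<forall>a i j. (\<Sum>b\<in>UNIV. \<Sum>k\<in>UNIV. \<Sum>l\<in>UNIV.
        rot3 (vector [vector [c, - d], vector [d, c]]) $ i $ l * T b $ l $ k *
        (vector [vector [c, - d], vector [d, c]] :: real^2^2) $ a $ b *
        rot3 (vector [vector [c, d], vector [- d, c]]) $ k $ j) = T a $ i $ j)"
    if "c^2 + d^2 = 1" for c d
    unfolding inv_def matrix_inv_rot3[OF that] ..
  show ?thesis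
  proof
    assume "isotropic_at_order lam e s 1"
    then have "inv (vector [vector [0, - 1], vector [1, 0]])"
      unfolding iso using rotation_in_SO2[of 0 1] by simp
    then have eq: "(\<Sum>b\<in>UNIV. \<Sum>k\<in>UNIV. \<Sum>l\<in>UNIV.
        rot3 (vector [vector [0, - 1], vector [1, 0]]) $ i $ l * T b $ l $ k *
        (vector [vector [0, - 1], vector [1, 0]] :: real^2^2) $ a $ b *
        rot3 (vector [vector [0, 1], vector [- 1, 0]]) $ k $ j) = T a $ i $ j" for a i j
      using inv_rot[of 0 1] by simp
    note expand = sum_2 sum_3 rot3_def cross
    \<comment> \<open>The arguments of \<open>eq\<close> are \<open>i\<close>, \<open>a\<close>,
      \<open>j\<close>, in order of first occurrence. The first two equations make the symmetric
      density column scalar. The others form pairs that differ by a sign: the half turn, the square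
      of the quarter turn, negates tensors with three vector indices.\<close>
    have "T 1 $ 2 $ 1 = T 2 $ 3 $ 1" "- T 1 $ 3 $ 1 = T 1 $ 3 $ 1"
      "- T 2 $ 3 $ 3 = T 1 $ 2 $ 2" "T 1 $ 2 $ 2 = T 2 $ 3 $ 3"
      "T 2 $ 3 $ 2 = T 1 $ 2 $ 3" "- T 1 $ 2 $ 3 = T 2 $ 3 $ 2"
      "T 1 $ 3 $ 3 = T 1 $ 3 $ 2" "- T 1 $ 3 $ 2 = T 1 $ 3 $ 3"
      subgoal using eq[of 2 1 1] by (simp add: expand)
      subgoal using eq[of 3 1 1] by (simp add: expand)
      subgoal using eq[of 2 1 2] by (simp add: expand)
      subgoal using eq[of 3 2 3] by (simp add: expand)
      subgoal using eq[of 2 1 3] by (simp add: expand)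
      subgoal using eq[of 3 2 2] by (simp add: expand)
      subgoal using eq[of 3 1 2] by (simp add: expand)
      subgoal using eq[of 3 1 3] by (simp add: expand)
      done
    then show ?cond
      by linarith
  next
    assume cond: ?cond
    show "isotropic_at_order lam e s 1"
      unfolding iso
    proof
      fix r
      assume "r \<in> SO2"
      then obtain c d where cd: "c^2 + d^2 = 1" and r: "r = vector [vector [c, - d], vector [d, c]]"
        by (rule SO2_cases)
      \<comment> \<open>The relation between \<open>c\<close> and \<open>d\<close> is oriented to
        eliminate squares of \<open>d\<close>, also inside right-nested products.\<close>
      have dd: "d * d = 1 - c * c"
        using cd by (simp add: power2_eq_square)
      then have ddu: "d * (d * u) = u - c * (c * u)" for u
        by (simp only: mult.assoc[symmetric] left_diff_distrib mult_1)
      show "inv r"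
        unfolding r inv_rot[OF cd]
        using cond by (simp add: forall_2 forall_3 sum_2 sum_3 rot3_def row1 cross algebra_simps dd ddu)
    qed
  qed
qed

theorem lemma20:
  fixes lam :: real and e :: "real^3^ymom" and s :: "real^ymom"
  assumes "lam > 0"
    and "\<And>k. 0 < s $ k \<and> s $ k < 2"
  shows "isotropic_at_order lam e s 1 \<longleftrightarrow>
    (e $ MEps $ 2 = 0 \<and> e $ MEps $ 3 = 0) \<and>
    ((e $ MPhiXX $ 1 = 0 \<and> e $ MPhiXX $ 2 = 0 \<and> e $ MPhiXX $ 3 = 0) \<and>
     (e $ MPhiXY $ 1 = 0 \<and> e $ MPhiXY $ 2 = 0 \<and> e $ MPhiXY $ 3 = 0))"
proof -
  have s: "s $ k \<noteq> 0" for k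
    using assms(2)[of k] by simp
  have E: "equilibrium_matrix lam e $ y $ k = 0 \<longleftrightarrow> e $ y $ k = 0" for y k
    using assms(1) exhaust_3[of k] by (auto simp: equilibrium_matrix_def)
  \<comment> \<open>In the density column, equality of the diagonal fluxes cancels the energy and
    leaves the \<open>MPhiXX\<close> coefficient. In the momentum columns both diagonal fluxes
    vanish, so their sum and difference give the energy and \<open>MPhiXX\<close>
    coefficients.\<close>
  have "isotropic_at_order lam e s 1 \<longleftrightarrow>
      (equilibrium_matrix lam e $ MEps $ 2 = 0 \<and> equilibrium_matrix lam e $ MEps $ 3 = 0) \<and>
      (equilibrium_matrix lam e $ MPhiXX $ 1 = 0 \<and> equilibrium_matrix lam e $ MPhiXX $ 2 = 0 \<and>
        equilibrium_matrix lam e $ MPhiXX $ 3 = 0) \<and>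
      (equilibrium_matrix lam e $ MPhiXY $ 1 = 0 \<and> equilibrium_matrix lam e $ MPhiXY $ 2 = 0 \<and>
        equilibrium_matrix lam e $ MPhiXY $ 3 = 0)"
    unfolding isotropic_1_iff_euler_flux[OF assms(1) s] euler_flux_simps[OF assms(1)]
    by (auto simp: mat_def)
  then show ?thesis
    unfolding E .
qed

end
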